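(* Let $0<\lambda\le 1/2$, let $\mathcal D\subseteq\mathbb R^2$ be the closed unit disk centered at the origin, and let $\mathcal D^o=\mathcal D\setminus\{0\}$. Then for any $p\ge 2$, $$\inf_{\phi\in\operatorname{Lip}_+^{\mathrm{inj}}(\mathcal D^o,\lambda\mathcal D^o)}E_p(\phi)=\min_{\phi\in\operatorname{Lip}_+^{\mathrm{inj}}(\mathcal D^o,\lambda\mathcal D^o)}E_p(\phi)=F^{p/2}(\lambda^2),$$ and the minimum is realized by a smooth diffeomorphism $\mathcal D^o\to\lambda\mathcal D^o$.
   Context: $\lambda\mathcal D^o=\{\lambda x:x\in\mathcal D^o\}$; both domains carry the Euclidean metric and standard orientation. $\operatorname{Lip}_+^{\mathrm{inj}}(\mathcal M,\mathcal N)$ is the set of Lipschitz maps $\phi:\mathcal M\to\mathcal N$ with $\det d\phi\ge0$ a.e. and $|\phi^{-1}(q)|\le1$ for a.e. $q\in\mathcal N$. With $\operatorname{dist}$ the Frobenius (Euclidean) distance on $2\times2$ matrices, $E_p(\phi)=\frac{1}{\operatorname{Area}(\mathcal M)}\int_{\mathcal M}\operatorname{dist}^p(d\phi,\operatorname{SO}_2)\,dx$. $F:[0,\infty)\to\mathbb R$ is $F(s)=1-2s$ for $0\le s\le\frac14$ and $F(s)=2(\sqrt s-1)^2$ for $s\ge\frac14$; $F^{p/2}(s)=(F(s))^{p/2}$. *)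

theory Defs
  imports "HOL-Analysis.Analysis"
begin

definition punctured_disk :: "(real^2) set" where
  "punctured_disk = cball 0 1 - {0}"

definition SO2 :: "(real^2^2) set" where
  "SO2 = {Q. rotation_matrix Q}"

(* Maps M -> N are represented by total functions whose values outside M are irrelevant;
   hence differentials are taken within M, which is the ordinary differential at interior points.
   The jacobian is unspecified where phi is not differentiable, so "det d phi >= 0 a.e."
   is read as: for a.e. x, d phi exists at x and has nonnegative determinant. The existence part
   is no restriction on Lipschitz maps, by Rademacher's theorem.
   Finiteness is required explicitly since card of an infinite set is 0. *)
definition Lip_inj_pos ::
    "(real^2) set \<Rightarrow> (real^2) set \<Rightarrow> (real^2 \<Rightarrow> real^2) set" where
  "Lip_inj_pos M N = {\<phi>. \<phi> \<in> M \<rightarrow> N \<and> (\<exists>L. L-lipschitz_on M \<phi>) \<and>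
     (AE x in lebesgue_on M. \<phi> differentiable (at x within M) \<and> 0 \<le> det (jacobian \<phi> (at x within M))) \<and>
     (AE q in lebesgue_on N. finite {x \<in> M. \<phi> x = q} \<and> card {x \<in> M. \<phi> x = q} \<le> 1)}"

(* The metric on real^2^2 is the Frobenius metric, so infdist is the Frobenius distance.
   For phi in Lip_inj_pos the integrand is essentially bounded and measurable, so the Bochner integral
   is the intended one. *)
definition energy :: "real \<Rightarrow> (real^2) set \<Rightarrow> (real^2 \<Rightarrow> real^2) \<Rightarrow> real" where
  "energy p M \<phi> =
     1 / measure lebesgue M * (\<integral>x. infdist (jacobian \<phi> (at x within M)) SO2 powr p \<partial>(lebesgue_on M))"

(* Only the values on [0, \<infinity>) are meaningful. *)
definition F :: "real \<Rightarrow> real" where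
  "F s = (if s \<le> 1/4 then 1 - 2 * s else 2 * (sqrt s - 1)\<^sup>2)"

primrec C_diff_on ::
    "nat \<Rightarrow> 'a::real_normed_vector set \<Rightarrow> ('a \<Rightarrow> 'b::real_normed_vector) \<Rightarrow> bool" where
  "C_diff_on 0 U f \<longleftrightarrow> continuous_on U f"
| "C_diff_on (Suc k) U f \<longleftrightarrow> (\<forall>x\<in>U. f differentiable (at x)) \<and>
     (\<forall>v. C_diff_on k U (\<lambda>x. frechet_derivative f (at x) v))"

(* Smoothness on a set that need not be open (here: containing boundary points):
   local existence of smooth extensions to open sets. *)
definition smooth_map_on ::
    "'a::real_normed_vector set \<Rightarrow> ('a \<Rightarrow> 'b::real_normed_vector) \<Rightarrow> bool" where
  "smooth_map_on M f \<longleftrightarrow>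
     (\<forall>x\<in>M. \<exists>U g. open U \<and> x \<in> U \<and> (\<forall>k. C_diff_on k U g) \<and> (\<forall>y\<in>M \<inter> U. g y = f y))"

definition smooth_diffeo ::
    "'a::real_normed_vector set \<Rightarrow> 'b::real_normed_vector set \<Rightarrow> ('a \<Rightarrow> 'b) \<Rightarrow> bool" where
  "smooth_diffeo M N f \<longleftrightarrow>
     bij_betw f M N \<and> smooth_map_on M f \<and> smooth_map_on N (inv_into M f)"

end

theory Submission
  imports Defs
begin

text \<open>For every \<open>2 \<times> 2\<close> matrix the squared distance to \<open>SO\<^sub>2\<close> is at least \<open>1 - 2 det\<close>, with
  equality when the singular values sum to \<open>1\<close>. A map that is injective up to null sets satisfies
  \<open>\<integral> det d\<phi> \<le> Area(\<lambda>D)\<close>, so the tangent line of \<open>y \<mapsto> y powr (p/2)\<close> at \<open>1 - 2\<lambda>\<^sup>2\<close> gives the lower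
  bound. It is attained by the logarithmic spiral map, which multiplies by \<open>\<lambda>\<close> and rotates by the
  angle \<open>b ln |x|\<close>: its singular values are constant with product \<open>\<lambda>\<^sup>2\<close>, and their sum is \<open>1\<close>
  for \<open>b\<^sup>2 = 1/\<lambda>\<^sup>2 - 4\<close>.\<close>

subsection \<open>Distance to rotations\<close>

lemma rotation_matrix_2_iff:
  fixes Q :: "real^2^2"
  shows "rotation_matrix Q \<longleftrightarrow>
    Q $ 2 $ 2 = Q $ 1 $ 1 \<and> Q $ 1 $ 2 = - Q $ 2 $ 1 \<and> (Q $ 1 $ 1)\<^sup>2 + (Q $ 2 $ 1)\<^sup>2 = 1"
    (is "_ \<longleftrightarrow> ?R")
proof
  assume Q: "rotation_matrix Q"
  let ?a = "Q $ 1 $ 1" and ?b = "Q $ 1 $ 2" and ?c = "Q $ 2 $ 1" and ?d = "Q $ 2 $ 2"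
  have 1: "?a * ?a + ?c * ?c = 1" "?b * ?b + ?d * ?d = 1" "?a * ?d - ?b * ?c = 1"
    using Q
    by (auto simp: rotation_matrix_def orthogonal_matrix vec_eq_iff matrix_matrix_mult_def
        transpose_def mat_def forall_2 sum_2 det_2)
  \<comment> \<open>The left side expands to the two squared column norms minus twice the
    determinant, that is 1 + 1 - 2.\<close>
  have "(?a - ?d)\<^sup>2 + (?b + ?c)\<^sup>2 = 0"
    using 1 by (simp add: power2_eq_square algebra_simps)
  then have "?a = ?d" "?b = - ?c"
    by (auto simp: add_nonneg_eq_0_iff)
  with 1 show ?R by (simp add: power2_eq_square)
next
  assume ?R
  then show "rotation_matrix Q"
    by (auto simp: rotation_matrix_def orthogonal_matrix vec_eq_iff matrix_matrix_mult_def
        transpose_def mat_def forall_2 sum_2 det_2 power2_eq_square)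
qed

lemma norm_matrix_2_power2:
  fixes A :: "real^2^2"
  shows "(norm A)\<^sup>2 = (A $ 1 $ 1)\<^sup>2 + (A $ 1 $ 2)\<^sup>2 + (A $ 2 $ 1)\<^sup>2 + (A $ 2 $ 2)\<^sup>2"
  unfolding power2_norm_eq_inner by (simp add: inner_vec_def sum_2 power2_eq_square)

text \<open>Complete the square. The pair t = \<open>A $ 1 $ 1 + A $ 2 $ 2\<close>, s =
  \<open>A $ 2 $ 1 - A $ 1 $ 2\<close> satisfies t^2 + s^2 = |A|^2 + 2 det A, and the inner product
  of \<open>A\<close> with \<open>Q\<close> is that of (t, s) with the first column of
  \<open>Q\<close>. Minimizing over rotations thus amounts to projecting (t, s) onto the unit
  circle.\<close>

lemma dist_rotation_power2:
  fixes A Q :: "real^2^2"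
  assumes "rotation_matrix Q"
  shows "(dist A Q)\<^sup>2 = 1 - 2 * det A + (A $ 1 $ 1 + A $ 2 $ 2 - Q $ 1 $ 1)\<^sup>2
    + (A $ 2 $ 1 - A $ 1 $ 2 - Q $ 2 $ 1)\<^sup>2"
proof -
  have Q: "Q $ 2 $ 2 = Q $ 1 $ 1" "Q $ 1 $ 2 = - Q $ 2 $ 1"
    "Q $ 1 $ 1 * Q $ 1 $ 1 + Q $ 2 $ 1 * Q $ 2 $ 1 = 1"
    using assms by (auto simp: rotation_matrix_2_iff power2_eq_square)
  show ?thesis
    using Q(3) unfolding dist_norm norm_matrix_2_power2
    by (simp add: det_2 Q power2_eq_square algebra_simps)
qed

lemma mat_1_in_SO2: "mat 1 \<in> SO2"
  by (simp add: SO2_def rotation_matrix_2_iff mat_def)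

lemma infdist_SO2_ge:
  fixes A :: "real^2^2"
  shows "1 - 2 * det A \<le> (infdist A SO2)\<^sup>2"
proof -
  \<comment> \<open>\<open>sqrt\<close> is odd, so for \<open>det A > 1/2\<close> the left side is
    negative and the bound remains valid.\<close>
  have "sqrt (1 - 2 * det A) \<le> dist A Q" if "Q \<in> SO2" for Q
    using that by (intro real_le_lsqrt) (auto simp: SO2_def dist_rotation_power2)
  then have "sqrt (1 - 2 * det A) \<le> infdist A SO2"
    using mat_1_in_SO2 by (subst infdist_notempty) (auto intro!: cINF_greatest)
  then show ?thesis by (rule sqrt_le_D)
qed

text \<open>The assumption puts the pair of trace and skew part on the unit circle, so it is the
  first column of a rotation for which both squares in \<open>dist_rotation_power2\<close> vanish.
  For \<open>det A \<ge> 0\<close> it says that the singular values of \<open>A\<close> sum to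
  1.\<close>

lemma infdist_SO2_eq:
  fixes A :: "real^2^2"
  assumes "(A $ 1 $ 1 + A $ 2 $ 2)\<^sup>2 + (A $ 2 $ 1 - A $ 1 $ 2)\<^sup>2 = 1"
  shows "(infdist A SO2)\<^sup>2 = 1 - 2 * det A"
proof (rule antisym)
  let ?c = "A $ 1 $ 1 + A $ 2 $ 2" and ?s = "A $ 2 $ 1 - A $ 1 $ 2"
  define Q :: "real^2^2" where "Q = vector [vector [?c, - ?s], vector [?s, ?c]]"
  have Q: "rotation_matrix Q"
    using assms by (simp add: rotation_matrix_2_iff Q_def)
  have "infdist A SO2 \<le> dist A Q"
    using Q by (intro infdist_le) (simp add: SO2_def)
  then have "(infdist A SO2)\<^sup>2 \<le> (dist A Q)\<^sup>2"
    by (simp add: infdist_nonneg power_mono)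
  also have "\<dots> = 1 - 2 * det A"
    by (simp add: dist_rotation_power2[OF Q]) (simp add: Q_def)
  finally show "(infdist A SO2)\<^sup>2 \<le> 1 - 2 * det A" .
qed (rule infdist_SO2_ge)

text \<open>For \<open>y > 0\<close> this is convexity of the power function on the open half-line.
  The endpoint \<open>y = 0\<close> lies outside and is checked directly: there the tangent line has
  the value \<open>(1 - q) * y0 powr q\<close>, which is not positive.\<close>

lemma powr_above_tangent:
  fixes q y y0 :: real
  assumes "1 \<le> q" "0 < y0" "0 \<le> y"
  shows "y0 powr q + q * y0 powr (q - 1) * (y - y0) \<le> y powr q"
proof (cases "y = 0")
  case True
  have "y0 powr (q - 1) * y0 = y0 powr q"
    using assms by (simp add: powr_diff)
  then have "y0 powr q + q * y0 powr (q - 1) * (y - y0) = (1 - q) * y0 powr q"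
    by (simp add: True algebra_simps)
  also have "\<dots> \<le> 0" using assms by (simp add: mult_nonpos_nonneg)
  finally show ?thesis using True assms by simp
next
  case False
  have "q * y0 powr (q - 1) * (y - y0) \<le> y powr q - y0 powr q"
  proof (rule convex_on_imp_above_tangent[where A = "{0<..}"])
    show "((\<lambda>x. x powr q) has_real_derivative q * y0 powr (q - 1)) (at y0 within {0<..})"
      using assms by (auto intro!: derivative_eq_intros)
  qed (use assms False in \<open>auto simp: powr_convex interior_open\<close>)
  then show ?thesis by simp
qed

subsection \<open>An area inequality for almost injective maps\<close>

text \<open>\<open>B\<close> is a countable union of pieces on which \<open>f\<close> has a locally Lipschitz inverse.\<close>

lemma negligible_vimage_injective_derivative:
  fixes f :: "'a::euclidean_space \<Rightarrow> 'b::euclidean_space"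
  assumes dim: "DIM('b) \<le> DIM('a)" and "negligible N" and sub: "f ` B \<subseteq> N"
    and der: "\<And>x. x \<in> B \<Longrightarrow> (f has_derivative f' x) (at x within B)"
    and inj: "\<And>x. x \<in> B \<Longrightarrow> inj (f' x)"
  shows "negligible B"
proof -
  \<comment> \<open>One index bounds both the radius of the neighbourhood and the expansion
    constant, so countably many pieces suffice.\<close>
  define E where "E n = {x \<in> B. \<forall>y\<in>B. norm (y - x) < 1 / real (Suc n) \<longrightarrow>
      norm (y - x) \<le> real (Suc n) * norm (f y - f x)}" for n
  have "B \<subseteq> (\<Union>n. E n)"
  proof
    fix x assume x: "x \<in> B"
    have lin: "linear (f' x)"
      using der[OF x] has_derivative_linear by blast
    \<comment> \<open>An injective linear map in finite dimension is bounded below; half of the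
      bound \<open>c\<close> will absorb the remainder of the first-order expansion.\<close>
    obtain c where c: "c > 0" "\<And>v. c * norm v \<le> norm (f' x v)"
      using linear_inj_bounded_below_pos[OF lin inj[OF x]] by blast
    obtain d where d: "d > 0" "\<And>y. y \<in> B \<Longrightarrow> norm (y - x) < d \<Longrightarrow>
        norm (f y - f x - f' x (y - x)) \<le> c / 2 * norm (y - x)"
      using der[OF x] c(1) unfolding has_derivative_within_alt by (meson half_gt_zero)
    \<comment> \<open>Beyond \<open>1 / d\<close> the neighbourhood fits into the radius
      \<open>d\<close>; beyond \<open>2 / c\<close> the constant \<open>Suc n\<close> dominates
      \<open>2 / c\<close>.\<close>
    obtain n where n: "max (1 / d) (2 / c) < real n"
      using reals_Archimedean2 by blast
    have "x \<in> E n"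
      unfolding E_def
    proof (intro CollectI conjI x ballI impI)
      fix y assume y: "y \<in> B" "norm (y - x) < 1 / real (Suc n)"
      have "1 / real (Suc n) < d"
        using n d(1) by (auto simp: field_simps)
      then have "norm (f y - f x - f' x (y - x)) \<le> c / 2 * norm (y - x)"
        using y by (intro d(2)) auto
      moreover have "norm (f' x (y - x)) \<le> norm (f y - f x) + norm (f y - f x - f' x (y - x))"
        by (metis add.commute diff_add_cancel norm_minus_commute norm_triangle_ineq)
      ultimately have "c / 2 * norm (y - x) \<le> norm (f y - f x)"
        using c(2)[of "y - x"] by simp
      then have "norm (y - x) \<le> 2 / c * norm (f y - f x)"
        using c(1) by (simp add: field_simps)
      also have "\<dots> \<le> real (Suc n) * norm (f y - f x)"
        using n by (intro mult_right_mono) auto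
      finally show "norm (y - x) \<le> real (Suc n) * norm (f y - f x)" .
    qed
    then show "x \<in> (\<Union>n. E n)" by blast
  qed
  moreover have "negligible (E n)" for n
    unfolding locally_negligible_alt[of "E n"]
  proof
    fix x assume "x \<in> E n"
    \<comment> \<open>Half the radius, so that any two points of \<open>V\<close> are less than
      \<open>1 / Suc n\<close> apart.\<close>
    define V where "V = E n \<inter> ball x (1 / (2 * real (Suc n)))"
    have V: "norm (y - z) \<le> real (Suc n) * norm (f y - f z)" if "y \<in> V" "z \<in> V" for y z
    proof -
      have "norm (y - z) < 1 / real (Suc n)"
        using that dist_triangle_half_r[of x y "1 / real (Suc n)" z]
        by (simp add: V_def dist_norm mult.commute)
      then show ?thesis
        using that by (auto simp: V_def E_def)
    qed
    then have inj: "inj_on f V"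
      by (fastforce simp: inj_on_def)
    have "negligible (f ` V)"
      using \<open>negligible N\<close> by (rule negligible_subset) (use sub in \<open>auto simp: V_def E_def\<close>)
    \<comment> \<open>The inverse of \<open>f\<close> on \<open>V\<close> is Lipschitz with constant
      \<open>Suc n\<close>, and Lipschitz maps into a space of no smaller dimension preserve null
      sets.\<close>
    then have "negligible (inv_into V f ` (f ` V))"
    proof (rule negligible_locally_Lipschitz_image[OF dim])
      fix w assume "w \<in> f ` V"
      then show "\<exists>T B. open T \<and> w \<in> T \<and>
          (\<forall>y\<in>f ` V \<inter> T. norm (inv_into V f y - inv_into V f w) \<le> B * norm (y - w))"
        using V inj by (intro exI[of _ UNIV] exI[of _ "real (Suc n)"]) auto
    qed
    then have "negligible V"
      using inj by simp
    then show "\<exists>U. openin (top_of_set (E n)) U \<and> x \<in> U \<and> negligible U"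
      using \<open>x \<in> E n\<close> by (intro exI[of _ V]) (auto simp: V_def)
  qed
  ultimately show ?thesis
    by (meson negligible_subset negligible_Union_nat)
qed

text \<open>Only points with positive determinant contribute. Among them, those mapped into
  \<open>N\<close> form a null set by the preceding lemma. On the remaining set \<open>R\<close> the
  map is injective, so the change of variables formula turns the integral into the measure of the
  image of \<open>R\<close>, a subset of \<open>T\<close>.\<close>

lemma integral_det_le_measure:
  fixes f :: "real^'n::{finite,wellorder} \<Rightarrow> real^'n::_"
  assumes S: "S \<in> sets lebesgue" and T: "T \<in> lmeasurable" "f ` S \<subseteq> T" and "negligible N"
    and der: "\<And>x. x \<in> S \<Longrightarrow> (f has_derivative f' x) (at x within S)"
    and nonneg: "\<And>x. x \<in> S \<Longrightarrow> 0 \<le> det (matrix (f' x))"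
    and inj: "inj_on f {x \<in> S. f x \<notin> N}"
  shows "(\<lambda>x. det (matrix (f' x))) absolutely_integrable_on S"
    and "integral S (\<lambda>x. det (matrix (f' x))) \<le> measure lebesgue T"
proof -
  let ?d = "\<lambda>x. det (matrix (f' x))"
  define P where "P = {x \<in> S. 0 < ?d x}"
  define Q where "Q = {x \<in> P. f x \<in> N}"
  have meas: "?d \<in> borel_measurable (lebesgue_on S)"
    using S der by (rule borel_measurable_det_Jacobian)
  have "P \<in> sets (lebesgue_on S)"
    using borel_measurable_less[OF borel_measurable_const meas, of 0]
    by (simp add: P_def space_restrict_space)
  then have P: "P \<in> sets lebesgue"
    using S by (auto simp: sets_restrict_space_iff)
  have "negligible Q"
  proof (rule negligible_vimage_injective_derivative[OF _ \<open>negligible N\<close>])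
    fix x assume "x \<in> Q"
    then have x: "x \<in> S" "?d x \<noteq> 0" by (auto simp: Q_def P_def)
    show "(f has_derivative f' x) (at x within Q)"
      using der[OF x(1)] by (rule has_derivative_subset) (auto simp: Q_def P_def)
    show "inj (f' x)"
      using x der[OF x(1)] has_derivative_linear det_nz_iff_inj by blast
  qed (auto simp: Q_def)
  define R where "R = P - Q"
  have R: "R \<in> sets lebesgue" "R \<subseteq> S"
    using P \<open>negligible Q\<close> negligible_imp_sets by (auto simp: R_def P_def)
  have derR: "(f has_derivative f' x) (at x within R)" if "x \<in> R" for x
    using der R(2) that has_derivative_subset by blast
  have injR: "inj_on f R"
    using inj by (rule inj_on_subset) (auto simp: R_def P_def Q_def)
  have "f ` R \<in> sets lebesgue"
    using R(1) by (rule differentiable_image_in_sets_lebesgue)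
      (use derR in \<open>auto simp: differentiable_on_def differentiable_def\<close>)
  then have fR: "f ` R \<in> lmeasurable" "measure lebesgue (f ` R) \<le> measure lebesgue T"
    using T R(2) by (auto intro!: fmeasurableI2[OF T(1)] measure_mono_fmeasurable)
  have "((\<lambda>x. \<bar>?d x\<bar>) has_integral measure lebesgue (f ` R)) R"
    using has_measure_differentiable_image[OF R(1) derR injR] fR(1) by blast
  then have "((\<lambda>x. if x \<in> R then \<bar>?d x\<bar> else 0) has_integral measure lebesgue (f ` R)) S"
    using R(2) by (simp add: has_integral_restrict)
  \<comment> \<open>Outside \<open>R\<close> and the null set \<open>Q\<close> the determinant
    vanishes, by \<open>nonneg\<close>.\<close>
  then have int: "(?d has_integral measure lebesgue (f ` R)) S"
    by (rule has_integral_spike[OF \<open>negligible Q\<close>, rotated])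
      (use nonneg in \<open>force simp: R_def P_def not_less\<close>)
  then show "?d absolutely_integrable_on S"
    using nonneg by (subst absolutely_integrable_on_iff_nonneg) auto
  show "integral S ?d \<le> measure lebesgue T"
    using int fR(2) integral_unique by metis
qed

text \<open>Supplies the pointwise bound that makes the energy density of a Lipschitz map
  integrable.\<close>

lemma norm_derivative_le_lipschitz:
  fixes f :: "'a::real_normed_vector \<Rightarrow> 'b::real_normed_vector"
  assumes "L-lipschitz_on U f" "open U" "x \<in> U" and der: "(f has_derivative f') (at x)"
  shows "norm (f' v) \<le> L * norm v"
proof (rule field_le_epsilon)
  fix e :: real assume "e > 0"
  \<comment> \<open>The \<open>+ 1\<close> keeps the quotient meaningful for \<open>v = 0\<close>;
    the same device serves in \<open>t\<close> below.\<close>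
  define e' where "e' = e / (norm v + 1)"
  have e': "e' > 0" "e' * norm v \<le> e"
    using \<open>e > 0\<close> by (auto simp: e'_def field_simps add_pos_nonneg)
  obtain d where d: "d > 0" "\<And>y. norm (y - x) < d \<Longrightarrow>
      norm (f y - f x - f' (y - x)) \<le> e' * norm (y - x)"
    using der e'(1) unfolding has_derivative_within_alt[where s = UNIV] by auto
  obtain r where r: "r > 0" "ball x r \<subseteq> U"
    using assms(2,3) openE by blast
  \<comment> \<open>Small enough that \<open>x + t *\<^sub>R v\<close> stays in the Lipschitz domain
    and in the range of the first-order estimate.\<close>
  define t where "t = min d r / (2 * (norm v + 1))"
  have t: "t > 0" "t * norm v < min d r"
  proof -
    show "t > 0" using d(1) r(1) by (auto simp: t_def add_nonneg_pos)
    have "t * norm v \<le> t * (norm v + 1)" using \<open>t > 0\<close> by simp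
    also have "\<dots> = min d r / 2"
      using add_nonneg_pos[OF norm_ge_zero zero_less_one, of v] by (simp add: t_def field_simps)
    also have "\<dots> < min d r"
      using d(1) r(1) half_gt_zero[of "min d r"] by linarith
    finally show "t * norm v < min d r" .
  qed
  let ?y = "x + t *\<^sub>R v"
  have "?y \<in> U" using t r(2) by (auto simp: dist_norm)
  then have "norm (f ?y - f x) \<le> L * norm (?y - x)"
    using lipschitz_onD[OF assms(1)] assms(3) by (metis dist_norm)
  moreover have "norm (f ?y - f x - f' (?y - x)) \<le> e' * norm (?y - x)"
    using t by (intro d(2)) auto
  ultimately have "norm (f' (?y - x)) \<le> (L + e') * norm (?y - x)"
    using norm_triangle_ineq4[of "f ?y - f x" "f ?y - f x - f' (?y - x)"]
    by (simp add: algebra_simps)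
  then have "t * norm (f' v) \<le> t * ((L + e') * norm v)"
    using t(1) linear_scale[OF has_derivative_linear[OF der]] by (simp add: ac_simps)
  then have "norm (f' v) \<le> (L + e') * norm v"
    using t(1) by simp
  then show "norm (f' v) \<le> L * norm v + e"
    using e'(2) by (simp add: algebra_simps)
qed

subsection \<open>Logarithmic spirals\<close>

text \<open>In complex notation, z is multiplied by a exp(i (b ln |z| + k)). For
  \<open>a > 0\<close> the offset \<open>k\<close> makes the family closed under inversion.
  Expanding along the two axes reduces differentiation to scalar coefficients.\<close>

definition spiral :: "real \<Rightarrow> real \<Rightarrow> real \<Rightarrow> real^2 \<Rightarrow> real^2" where
  "spiral a b k x =
    (a * (cos (b * ln (norm x) + k) * x $ 1 - sin (b * ln (norm x) + k) * x $ 2)) *\<^sub>R axis 1 1 +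
    (a * (sin (b * ln (norm x) + k) * x $ 1 + cos (b * ln (norm x) + k) * x $ 2)) *\<^sub>R axis 2 1"

lemma spiral_nth:
  "spiral a b k x $ 1 = a * (cos (b * ln (norm x) + k) * x $ 1 - sin (b * ln (norm x) + k) * x $ 2)"
  "spiral a b k x $ 2 = a * (sin (b * ln (norm x) + k) * x $ 1 + cos (b * ln (norm x) + k) * x $ 2)"
  by (simp_all add: spiral_def axis_def)

lemma norm_vec_2_power2: "(norm (x :: real^2))\<^sup>2 = (x $ 1)\<^sup>2 + (x $ 2)\<^sup>2"
  unfolding power2_norm_eq_inner by (simp add: inner_vec_def sum_2 power2_eq_square)

lemma norm_rotate_2:
  fixes x y :: "real^2"
  assumes "c\<^sup>2 + s\<^sup>2 = 1" "y $ 1 = c * x $ 1 - s * x $ 2" "y $ 2 = s * x $ 1 + c * x $ 2"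
  shows "norm y = norm x"
proof -
  have "(norm y)\<^sup>2 = (c\<^sup>2 + s\<^sup>2) * ((x $ 1)\<^sup>2 + (x $ 2)\<^sup>2)"
    unfolding norm_vec_2_power2 assms(2,3) by (simp add: power2_eq_square algebra_simps)
  then have "(norm y)\<^sup>2 = (norm x)\<^sup>2"
    unfolding norm_vec_2_power2[of x] assms(1) by simp
  then show ?thesis by simp
qed

lemma norm_spiral: "norm (spiral a b k x) = \<bar>a\<bar> * norm x"
proof -
  let ?t = "b * ln (norm x) + k"
  define y :: "real^2" where "y = vector [cos ?t * x $ 1 - sin ?t * x $ 2, sin ?t * x $ 1 + cos ?t * x $ 2]"
  have "spiral a b k x = a *\<^sub>R y"
    by (simp add: vec_eq_iff forall_2 spiral_nth y_def)
  moreover have "norm y = norm x"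
    by (rule norm_rotate_2[where c = "cos ?t" and s = "sin ?t"]) (simp_all add: y_def)
  ultimately show ?thesis by simp
qed

text \<open>The map scales norms by \<open>a\<close>, so the phase can be read off the image: its
  logarithmic norm exceeds that of \<open>x\<close> by \<open>ln a\<close>, and the offset
  \<open>b * ln a - k\<close> turns the phase of the second spiral into minus that of the
  first.\<close>

lemma spiral_inverse:
  assumes "a > 0" "x \<noteq> 0"
  shows "spiral (1 / a) (- b) (b * ln a - k) (spiral a b k x) = x"
proof -
  define y where "y = spiral a b k x"
  define t where "t = b * ln (norm x) + k"
  have y: "y $ 1 = a * (cos t * x $ 1 - sin t * x $ 2)" "y $ 2 = a * (sin t * x $ 1 + cos t * x $ 2)"
    by (simp_all add: y_def t_def spiral_nth)
  have "- b * ln (norm y) + (b * ln a - k) = - t"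
    using assms by (simp add: y_def norm_spiral ln_mult t_def algebra_simps)
  then have z: "spiral (1 / a) (- b) (b * ln a - k) y $ 1 = 1 / a * (cos t * y $ 1 + sin t * y $ 2)"
    "spiral (1 / a) (- b) (b * ln a - k) y $ 2 = 1 / a * (cos t * y $ 2 - sin t * y $ 1)"
    unfolding spiral_nth by simp_all
  have "1 / a * (cos t * y $ 1 + sin t * y $ 2) = ((sin t)\<^sup>2 + (cos t)\<^sup>2) * x $ 1"
    "1 / a * (cos t * y $ 2 - sin t * y $ 1) = ((sin t)\<^sup>2 + (cos t)\<^sup>2) * x $ 2"
    unfolding y using assms(1)
    by (simp_all add: power2_eq_square field_simps del: sin_cos_squared_add sin_cos_squared_add2 sin_cos_squared_add3)
  with z show ?thesis
    by (simp add: vec_eq_iff forall_2 flip: y_def)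
qed

text \<open>The left side is the squared distance between two rotations of \<open>x\<close>. A chord
  of the unit circle is no longer than its arc, since 2 - 2 cos u = 4 sin^2 (u/2).\<close>

lemma norm_rotation_diff_le:
  fixes x :: "real^2"
  shows "((cos s - cos t) * x $ 1 - (sin s - sin t) * x $ 2)\<^sup>2 +
    ((sin s - sin t) * x $ 1 + (cos s - cos t) * x $ 2)\<^sup>2 \<le> ((s - t) * norm x)\<^sup>2"
proof -
  have "(cos s - cos t)\<^sup>2 + (sin s - sin t)\<^sup>2 = 2 - 2 * cos (s - t)"
    using sin_cos_squared_add[of s] sin_cos_squared_add[of t]
    by (simp add: cos_diff power2_eq_square algebra_simps)
  also have "\<dots> = 4 * (sin ((s - t) / 2))\<^sup>2"
  proof -
    have "cos (s - t) = cos (2 * ((s - t) / 2))"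
      by (rule arg_cong[of _ _ cos]) simp
    then show ?thesis unfolding cos_double_sin by simp
  qed
  also have "\<dots> \<le> 4 * ((s - t) / 2)\<^sup>2"
    using abs_sin_x_le_abs_x[of "(s - t) / 2"] by (intro mult_left_mono) (auto simp only: abs_le_square_iff)
  also have "\<dots> = (s - t)\<^sup>2" by (simp add: power2_eq_square)
  finally have "((cos s - cos t)\<^sup>2 + (sin s - sin t)\<^sup>2) * (norm x)\<^sup>2 \<le> (s - t)\<^sup>2 * (norm x)\<^sup>2"
    by (rule mult_right_mono) simp
  \<comment> \<open>Multiplicativity of the complex modulus.\<close>
  moreover have "(p * u - q * v)\<^sup>2 + (q * u + p * v)\<^sup>2 = (p\<^sup>2 + q\<^sup>2) * (u\<^sup>2 + v\<^sup>2)" for p q u v :: real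
    by (simp add: power2_eq_square algebra_simps)
  ultimately show ?thesis
    by (simp add: norm_vec_2_power2 power_mult_distrib)
qed

text \<open>The difference splits into one rotation applied to \<open>x - y\<close> and a change of
  rotation applied to the point \<open>y\<close> of smaller norm. The second part is at most |b| |y|
  ln (|x|/|y|), and ln u \<le> u - 1 bounds this by |b| (|x| - |y|), uniformly up to the
  origin.\<close>

lemma spiral_lipschitz: "(\<bar>a\<bar> * (1 + \<bar>b\<bar>))-lipschitz_on (- {0}) (spiral a b k)"
proof (rule lipschitz_onI)
  have main: "dist (spiral a b k x) (spiral a b k y) \<le> \<bar>a\<bar> * (1 + \<bar>b\<bar>) * dist x y"
    if "x \<noteq> 0" "y \<noteq> 0" "norm y \<le> norm x" for x y
  proof -
    let ?s = "b * ln (norm x) + k" and ?t = "b * ln (norm y) + k"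
    define z :: "real^2" where "z = vector
      [cos ?s * (x - y) $ 1 - sin ?s * (x - y) $ 2, sin ?s * (x - y) $ 1 + cos ?s * (x - y) $ 2]"
    define w :: "real^2" where "w = vector
      [(cos ?s - cos ?t) * y $ 1 - (sin ?s - sin ?t) * y $ 2,
       (sin ?s - sin ?t) * y $ 1 + (cos ?s - cos ?t) * y $ 2]"
    have eq: "spiral a b k x - spiral a b k y = a *\<^sub>R (z + w)"
      by (simp add: vec_eq_iff forall_2 spiral_nth z_def w_def algebra_simps)
    have z: "norm z = norm (x - y)"
      by (rule norm_rotate_2[where c = "cos ?s" and s = "sin ?s"]) (simp_all add: z_def)
    have "norm w \<le> \<bar>(?s - ?t) * norm y\<bar>"
      using norm_rotation_diff_le[of ?s ?t y] abs_le_square_iff[of "norm w" "(?s - ?t) * norm y"]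
      unfolding norm_vec_2_power2[of w] by (simp add: w_def)
    also have "\<dots> = \<bar>b\<bar> * (ln (norm x / norm y) * norm y)"
      using that by (simp add: ln_div abs_mult flip: right_diff_distrib)
    also have "\<dots> \<le> \<bar>b\<bar> * ((norm x / norm y - 1) * norm y)"
      using that by (intro mult_left_mono mult_right_mono ln_le_minus_one) auto
    also have "\<dots> = \<bar>b\<bar> * (norm x - norm y)"
      using that by (simp add: field_simps)
    also have "\<dots> \<le> \<bar>b\<bar> * norm (x - y)"
      by (intro mult_left_mono norm_triangle_ineq2) simp
    finally have "norm (z + w) \<le> (1 + \<bar>b\<bar>) * norm (x - y)"
      using z norm_triangle_ineq[of z w] by (simp add: algebra_simps)
    then show ?thesis
      by (simp add: dist_norm eq mult.assoc mult_left_mono)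
  qed
  show "dist (spiral a b k x) (spiral a b k y) \<le> \<bar>a\<bar> * (1 + \<bar>b\<bar>) * dist x y"
    if "x \<in> - {0}" "y \<in> - {0}" for x y
    using main[of x y] main[of y x] that by (cases "norm y \<le> norm x") (auto simp: dist_commute)
qed simp

text \<open>Written with \<open>inverse (x \<bullet> x)\<close>, so that this derivative is built
  from generators of the class \<open>log_polar\<close> below.\<close>

lemma has_derivative_ln_norm:
  fixes x :: "'a::real_inner"
  assumes "x \<noteq> 0"
  shows "((\<lambda>x. ln (norm x)) has_derivative (\<lambda>v. (x \<bullet> v) * inverse (x \<bullet> x))) (at x)"
proof -
  have "(norm has_derivative (\<lambda>v. v \<bullet> sgn x)) (at x)"
    using has_derivative_norm[OF assms] by simp
  from has_derivative_ln[OF _ this] assms show ?thesis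
    by (auto simp: sgn_div_norm inner_scaleR_left field_simps inner_commute simp flip: power2_norm_eq_inner power2_eq_square
       elim!: has_derivative_eq_rhs)
qed

lemma has_derivative_log_phase:
  assumes "x \<noteq> 0"
  shows "((\<lambda>x :: 'a :: real_inner. b * ln (norm x) + k) has_derivative
    (\<lambda>v. b * ((x \<bullet> v) * inverse (x \<bullet> x)))) (at x)"
  by (intro has_derivative_add_const has_derivative_mult_right has_derivative_ln_norm assms)

lemma jacobian_entries:
  fixes f :: "real^'n \<Rightarrow> real^'m"
  assumes "(f has_derivative f') (at x)"
  shows "jacobian f (at x) $ i $ j = f' (axis j 1) $ i"
  using frechet_derivative_at[OF assms] by (simp add: jacobian_def matrix_def)

text \<open>The phase has gradient b x / |x|^2. Hence the differential is \<open>a\<close> times a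
  rotation times the shear with rows (1, 0) and (b, 1) in the orthonormal frame of radial and
  angular directions. The shear has determinant 1, trace 2 and skew part \<open>b\<close>; the
  rotation merely rotates the pair (2, b).\<close>

lemma spiral_derivative_entries:
  fixes x :: "real^2" and a b k :: real
  defines "A \<equiv> jacobian (spiral a b k) (at x)"
  assumes x: "x \<noteq> 0"
  shows "spiral a b k differentiable (at x)"
    and "det A = a\<^sup>2"
    and "(A $ 1 $ 1 + A $ 2 $ 2)\<^sup>2 + (A $ 2 $ 1 - A $ 1 $ 2)\<^sup>2 = a\<^sup>2 * (4 + b\<^sup>2)"
proof -
  define c where "c = cos (b * ln (norm x) + k)"
  define s where "s = sin (b * ln (norm x) + k)"
  define r where "r = inverse (x \<bullet> x)"
  define D :: "real^2 \<Rightarrow> real^2" where "D v =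
      (a * (c * v $ 1 - s * v $ 2 - b * ((x \<bullet> v) * r) * (s * x $ 1 + c * x $ 2))) *\<^sub>R axis 1 1 +
      (a * (s * v $ 1 + c * v $ 2 + b * ((x \<bullet> v) * r) * (c * x $ 1 - s * x $ 2))) *\<^sub>R axis 2 1" for v
  have ph: "((\<lambda>x. b * ln (norm x) + k) has_derivative (\<lambda>v. b * ((x \<bullet> v) * r))) (at x)"
    unfolding r_def using x by (rule has_derivative_log_phase)
  have co: "((\<lambda>x. cos (b * ln (norm x) + k)) has_derivative (\<lambda>v. b * ((x \<bullet> v) * r) * - s)) (at x)"
    using has_derivative_cos[OF ph] by (simp add: s_def)
  have si: "((\<lambda>x. sin (b * ln (norm x) + k)) has_derivative (\<lambda>v. b * ((x \<bullet> v) * r) * c)) (at x)"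
    using has_derivative_sin[OF ph] by (simp add: c_def)
  have nth: "((\<lambda>x. x $ i) has_derivative (\<lambda>v. v $ i)) (at x)" for i
    by (intro bounded_linear.has_derivative[OF bounded_linear_vec_nth] has_derivative_ident)
  have D: "(spiral a b k has_derivative D) (at x)"
    unfolding spiral_def[abs_def]
    by (rule has_derivative_eq_rhs,
        (rule has_derivative_add has_derivative_scaleR_left has_derivative_mult_right
          has_derivative_diff has_derivative_mult co si nth)+)
       (simp add: fun_eq_iff D_def c_def s_def algebra_simps)
  then show "spiral a b k differentiable (at x)"
    by (auto simp: differentiable_def)
  have A: "A $ i $ j = D (axis j 1) $ i" for i j
    unfolding A_def by (rule jacobian_entries[OF D])
  have entries:
    "A $ 1 $ 1 = a * (c - b * (x $ 1 * r) * (s * x $ 1 + c * x $ 2))"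
    "A $ 1 $ 2 = a * (- s - b * (x $ 2 * r) * (s * x $ 1 + c * x $ 2))"
    "A $ 2 $ 1 = a * (s + b * (x $ 1 * r) * (c * x $ 1 - s * x $ 2))"
    "A $ 2 $ 2 = a * (c + b * (x $ 2 * r) * (c * x $ 1 - s * x $ 2))"
    by (simp_all add: A D_def axis_def inner_axis inner_vec_def sum_2)
  have r: "r * (x $ 1 * x $ 1 + x $ 2 * x $ 2) = 1"
  proof -
    have "x $ 1 * x $ 1 + x $ 2 * x $ 2 = x \<bullet> x"
      by (simp add: inner_vec_def sum_2)
    then show ?thesis using x by (simp add: r_def)
  qed
  have cs: "c\<^sup>2 + s\<^sup>2 = 1"
    by (simp add: c_def s_def)
  have "det A = a\<^sup>2 * (c\<^sup>2 + s\<^sup>2)"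
    unfolding det_2 entries by (simp add: power2_eq_square algebra_simps)
  then show "det A = a\<^sup>2"
    by (simp add: cs)
  have tr: "A $ 1 $ 1 + A $ 2 $ 2 = a * (2 * c - b * s * (r * (x $ 1 * x $ 1 + x $ 2 * x $ 2)))"
    "A $ 2 $ 1 - A $ 1 $ 2 = a * (2 * s + b * c * (r * (x $ 1 * x $ 1 + x $ 2 * x $ 2)))"
    unfolding entries by (simp_all add: algebra_simps)
  have "(A $ 1 $ 1 + A $ 2 $ 2)\<^sup>2 + (A $ 2 $ 1 - A $ 1 $ 2)\<^sup>2 = a\<^sup>2 * (4 + b\<^sup>2) * (c\<^sup>2 + s\<^sup>2)"
    unfolding tr r by (simp add: power2_eq_square algebra_simps)
  then show "(A $ 1 $ 1 + A $ 2 $ 2)\<^sup>2 + (A $ 2 $ 1 - A $ 1 $ 2)\<^sup>2 = a\<^sup>2 * (4 + b\<^sup>2)"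
    by (simp add: cs)
qed

section \<open>Smoothness of the spirals\<close>

text \<open>Agreement on \<open>U\<close> rather than equality of functions: derivatives are junk off \<open>U\<close>.\<close>

lemma C_diff_on_derivation_closed:
  assumes "open U" and "f \<in> G" and "\<And>x. x \<in> U \<Longrightarrow> h x = f x"
    and closed: "\<And>f. f \<in> G \<Longrightarrow>
      \<exists>f'. (\<forall>x\<in>U. (f has_derivative f' x) (at x)) \<and> (\<forall>v. (\<lambda>x. f' x v) \<in> G)"
  shows "C_diff_on k U h"
  using assms(2,3)
proof (induction k arbitrary: f h)
  case (0 f h)
  obtain f' where "\<forall>x\<in>U. (f has_derivative f' x) (at x)"
    using closed[OF 0(1)] by blast
  then have "continuous_on U f"
    by (meson continuous_at_imp_continuous_on has_derivative_continuous)
  then show ?case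
    using 0(2) by (simp cong: continuous_on_cong)
next
  case (Suc k f h)
  obtain f' where f': "\<And>x. x \<in> U \<Longrightarrow> (f has_derivative f' x) (at x)" "\<And>v. (\<lambda>x. f' x v) \<in> G"
    using closed[OF Suc(2)] by blast
  have h: "(h has_derivative f' x) (at x)" if "x \<in> U" for x
    using f'(1)[OF that] \<open>open U\<close> that
    by (rule has_derivative_transform_within_open) (use Suc(3) in auto)
  then have "C_diff_on k U (\<lambda>x. frechet_derivative h (at x) v)" for v
    using frechet_derivative_at[OF h] by (intro Suc.IH[OF f'(2)[of v]]) metis
  then show ?case
    using h by (auto simp: differentiable_def)
qed

text \<open>A class of functions closed under differentiation that contains the coordinates of spirals.\<close>

inductive_set log_polar :: "real \<Rightarrow> real \<Rightarrow> (real^2 \<Rightarrow> real) set" for b k where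
  const: "(\<lambda>x. r) \<in> log_polar b k"
| nth: "(\<lambda>x. x $ i) \<in> log_polar b k"
| inv: "(\<lambda>x. inverse (x \<bullet> x)) \<in> log_polar b k"
| cos: "(\<lambda>x. cos (b * ln (norm x) + k)) \<in> log_polar b k"
| sin: "(\<lambda>x. sin (b * ln (norm x) + k)) \<in> log_polar b k"
| add: "f \<in> log_polar b k \<Longrightarrow> g \<in> log_polar b k \<Longrightarrow> (\<lambda>x. f x + g x) \<in> log_polar b k"
| mult: "f \<in> log_polar b k \<Longrightarrow> g \<in> log_polar b k \<Longrightarrow> (\<lambda>x. f x * g x) \<in> log_polar b k"

lemma log_polar_inner: "(\<lambda>x. x \<bullet> v) \<in> log_polar b k"
  unfolding inner_vec_def sum_2 inner_real_def by (intro log_polar.intros)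

lemma log_polar_derivative:
  assumes "f \<in> log_polar b k"
  shows "\<exists>f'. (\<forall>x\<in>- {0}. (f has_derivative f' x) (at x)) \<and> (\<forall>v. (\<lambda>x. f' x v) \<in> log_polar b k)"
  using assms
proof induction
  case (const r)
  show ?case
    by (rule exI[of _ "\<lambda>x v. 0"]) (auto intro: log_polar.const)
next
  case (nth i)
  show ?case
    by (rule exI[of _ "\<lambda>x v. v $ i"])
      (auto intro: log_polar.const bounded_linear.has_derivative[OF bounded_linear_vec_nth])
next
  case inv
  \<comment> \<open>Negation and powers are not among the generators of the class, so the sign is a
    constant factor and the square a product.\<close>
  have "((\<lambda>x. inverse (x \<bullet> x)) has_derivative
      (\<lambda>v. (- 2) * ((x \<bullet> v) * (inverse (x \<bullet> x) * inverse (x \<bullet> x))))) (at x)"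
    if "x \<noteq> 0" for x :: "real^2"
    by (rule has_derivative_eq_rhs[OF Deriv.has_derivative_inverse[OF _
          has_derivative_inner[OF has_derivative_ident has_derivative_ident]]])
      (use that in \<open>auto simp: inner_commute algebra_simps\<close>)
  then show ?case
    by (intro exI[of _ "\<lambda>x v. (- 2) * ((x \<bullet> v) * (inverse (x \<bullet> x) * inverse (x \<bullet> x)))"]
        conjI allI ballI log_polar.intros log_polar_inner) auto
next
  case cos
  have "((\<lambda>x. cos (b * ln (norm x) + k)) has_derivative
      (\<lambda>v. b * ((x \<bullet> v) * inverse (x \<bullet> x)) * ((- 1) * sin (b * ln (norm x) + k)))) (at x)"
    if "x \<noteq> 0" for x :: "real^2"
    using has_derivative_cos[OF has_derivative_log_phase[OF that]] by simp
  then show ?case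
    by (intro exI[of _ "\<lambda>x v. b * ((x \<bullet> v) * inverse (x \<bullet> x)) * ((- 1) * sin (b * ln (norm x) + k))"]
        conjI allI ballI log_polar.intros log_polar_inner) auto
next
  case sin
  have "((\<lambda>x. sin (b * ln (norm x) + k)) has_derivative
      (\<lambda>v. b * ((x \<bullet> v) * inverse (x \<bullet> x)) * cos (b * ln (norm x) + k))) (at x)"
    if "x \<noteq> 0" for x :: "real^2"
    using has_derivative_sin[OF has_derivative_log_phase[OF that]] by simp
  then show ?case
    by (intro exI[of _ "\<lambda>x v. b * ((x \<bullet> v) * inverse (x \<bullet> x)) * cos (b * ln (norm x) + k)"]
        conjI allI ballI log_polar.intros log_polar_inner) auto
next
  case (add f g)
  then obtain f' g' where
    "\<forall>x\<in>- {0}. (f has_derivative f' x) (at x)" "\<forall>v. (\<lambda>x. f' x v) \<in> log_polar b k"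
    "\<forall>x\<in>- {0}. (g has_derivative g' x) (at x)" "\<forall>v. (\<lambda>x. g' x v) \<in> log_polar b k"
    by blast
  then show ?case
    by (intro exI[of _ "\<lambda>x v. f' x v + g' x v"]) (auto intro!: has_derivative_add log_polar.add)
next
  case (mult f g)
  then obtain f' g' where
    "\<forall>x\<in>- {0}. (f has_derivative f' x) (at x)" "\<forall>v. (\<lambda>x. f' x v) \<in> log_polar b k"
    "\<forall>x\<in>- {0}. (g has_derivative g' x) (at x)" "\<forall>v. (\<lambda>x. g' x v) \<in> log_polar b k"
    by blast
  with mult.hyps show ?case
    by (intro exI[of _ "\<lambda>x v. f x * g' x v + f' x v * g x"])
      (auto intro!: has_derivative_mult log_polar.add log_polar.mult)
qed

text \<open>The planar maps whose two coordinates lie in \<open>log_polar\<close> inherit closure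
  under directional derivatives, which gives all orders of differentiability at once.\<close>

lemma C_diff_on_spiral: "C_diff_on n (- {0}) (spiral a b k)"
proof -
  let ?G = "{\<lambda>x. f x *\<^sub>R axis 1 1 + g x *\<^sub>R axis 2 1 :: real^2 |f g.
    f \<in> log_polar b k \<and> g \<in> log_polar b k}"
  have "(\<lambda>x. a * (cos (b * ln (norm x) + k) * x $ 1 + (- 1) * (sin (b * ln (norm x) + k) * x $ 2)))
      \<in> log_polar b k"
    "(\<lambda>x. a * (sin (b * ln (norm x) + k) * x $ 1 + cos (b * ln (norm x) + k) * x $ 2))
      \<in> log_polar b k"
    by (intro log_polar.intros)+
  then have spiral: "spiral a b k \<in> ?G"
    unfolding spiral_def[abs_def] by auto
  have G: "(\<lambda>x. f x *\<^sub>R axis 1 1 + g x *\<^sub>R axis 2 1) \<in> ?G"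
    if "f \<in> log_polar b k" "g \<in> log_polar b k" for f g
    using that by blast
  have "\<exists>h'. (\<forall>x\<in>- {0}. (h has_derivative h' x) (at x)) \<and> (\<forall>v. (\<lambda>x. h' x v) \<in> ?G)"
    if "h \<in> ?G" for h
  proof -
    obtain f g where h: "h = (\<lambda>x. f x *\<^sub>R axis 1 1 + g x *\<^sub>R axis 2 1)"
      and f: "f \<in> log_polar b k" and g: "g \<in> log_polar b k"
      using \<open>h \<in> ?G\<close> by blast
    from log_polar_derivative[OF f] obtain f' where
      f': "\<And>x. x \<noteq> 0 \<Longrightarrow> (f has_derivative f' x) (at x)" "\<And>v. (\<lambda>x. f' x v) \<in> log_polar b k"
      by auto
    from log_polar_derivative[OF g] obtain g' where
      g': "\<And>x. x \<noteq> 0 \<Longrightarrow> (g has_derivative g' x) (at x)" "\<And>v. (\<lambda>x. g' x v) \<in> log_polar b k"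
      by auto
    have "\<forall>x\<in>- {0}. (h has_derivative
        (\<lambda>v. f' x v *\<^sub>R axis 1 1 + g' x v *\<^sub>R axis 2 1)) (at x)"
      unfolding h using f'(1) g'(1) by (auto intro!: has_derivative_add has_derivative_scaleR_left)
    moreover have "\<forall>v. (\<lambda>x. f' x v *\<^sub>R axis 1 1 + g' x v *\<^sub>R axis 2 1) \<in> ?G"
      using G[OF f'(2) g'(2)] by (rule allI)
    ultimately show ?thesis
      by (intro exI[of _ "\<lambda>x v. f' x v *\<^sub>R axis 1 1 + g' x v *\<^sub>R axis 2 1"] conjI)
  qed
  then show ?thesis
    using C_diff_on_derivation_closed[of "- {0}" "spiral a b k" ?G "spiral a b k" n] spiral by blast
qed

subsection \<open>Energy estimates\<close>

text \<open>Integrability need not be assumed: it holds on both sets or on neither, and in the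
  latter case both Bochner integrals are 0 by convention.\<close>

lemma integral_lebesgue_on_spike_set:
  fixes f :: "'a::euclidean_space \<Rightarrow> 'b::euclidean_space"
  assumes S: "S \<in> sets lebesgue" and T: "T \<in> sets lebesgue" "T \<subseteq> S" and neg: "negligible (S - T)"
  shows "integral\<^sup>L (lebesgue_on S) f = integral\<^sup>L (lebesgue_on T) f"
proof -
  have neg: "negligible {x \<in> S - T. f x \<noteq> 0}" "negligible {x \<in> T - S. f x \<noteq> 0}"
    using neg T(2) by (auto intro: negligible_subset simp: Diff_eq_empty_iff[THEN iffD2])
  have *: "integrable (lebesgue_on U) f \<longleftrightarrow> f absolutely_integrable_on U" if "U \<in> sets lebesgue" for U
    using that by (simp add: integrable_restrict_space set_integrable_def)
  show ?thesis
  proof (cases "integrable (lebesgue_on S) f")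
    case True
    then have "integrable (lebesgue_on T) f"
      using * S T(1) absolutely_integrable_spike_set_eq[OF neg] by blast
    with True S T(1) integral_spike_set[OF neg] show ?thesis
      by (simp add: lebesgue_integral_eq_integral)
  next
    case False
    then have "\<not> integrable (lebesgue_on T) f"
      using * S T(1) absolutely_integrable_spike_set_eq[OF neg] by blast
    with False show ?thesis
      by (simp add: not_integrable_integral_eq)
  qed
qed

text \<open>Trades differentials within \<open>M\<close> for ordinary ones: the two filters coincide
  at interior points, and the remaining points form a null set.\<close>

lemma energy_eq_interior:
  assumes "M \<in> sets lebesgue" "G \<in> sets lebesgue" "G \<subseteq> interior M" "negligible (M - G)"
  shows "energy p M \<phi> = 1 / measure lebesgue M *
    (\<integral>x. infdist (jacobian \<phi> (at x)) SO2 powr p \<partial>(lebesgue_on G))"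
proof -
  have "(\<integral>x. infdist (jacobian \<phi> (at x within M)) SO2 powr p \<partial>(lebesgue_on M)) =
      (\<integral>x. infdist (jacobian \<phi> (at x within M)) SO2 powr p \<partial>(lebesgue_on G))"
    using assms interior_subset by (intro integral_lebesgue_on_spike_set) blast+
  also have "\<dots> = (\<integral>x. infdist (jacobian \<phi> (at x)) SO2 powr p \<partial>(lebesgue_on G))"
    using assms(3) at_within_interior[of _ M]
    by (intro Bochner_Integration.integral_cong) (auto simp: subset_iff)
  finally show ?thesis by (simp add: energy_def)
qed

lemma norm_matrix_2_le:
  fixes A :: "real^2^2"
  assumes "\<And>i j. \<bar>A $ i $ j\<bar> \<le> L"
  shows "norm A \<le> 2 * L"
proof (rule power2_le_imp_le)
  have "(A $ i $ j)\<^sup>2 \<le> L\<^sup>2" for i j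
    using assms[of i j] power_mono[of "\<bar>A $ i $ j\<bar>" L 2] by simp
  from this[of 1 1] this[of 1 2] this[of 2 1] this[of 2 2]
  show "(norm A)\<^sup>2 \<le> (2 * L)\<^sup>2"
    unfolding norm_matrix_2_power2 by (simp add: power_mult_distrib)
  show "0 \<le> 2 * L"
    using assms[of 1 1] by linarith
qed

lemma powr_power2_half:
  fixes y :: real
  assumes "0 \<le> y"
  shows "(y\<^sup>2) powr (p / 2) = y powr p"
proof (cases "y = 0")
  case False
  then have "y\<^sup>2 = y powr 2"
    using assms by simp
  then show ?thesis
    by (simp only: powr_powr) simp
qed simp

lemma AE_lebesgue_on_iff_negligible:
  assumes "S \<in> sets lebesgue"
  shows "(AE x in lebesgue_on S. P x) \<longleftrightarrow> negligible {x \<in> S. \<not> P x}"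
proof -
  have "(AE x in lebesgue_on S. P x) \<longleftrightarrow> (AE x in lebesgue. x \<in> S \<longrightarrow> P x)"
    using assms by (simp add: AE_restrict_space_iff)
  also have "\<dots> \<longleftrightarrow> negligible {x \<in> S. \<not> P x}"
    unfolding eventually_ae_filter_negligible by (auto intro: negligible_subset)
  finally show ?thesis .
qed

text \<open>The hypothesis \<open>small\<close> makes the tangent point positive. As a function of
  the determinant the tangent bound is affine with nonpositive slope, so an upper bound on the
  integrated determinant yields a lower bound on the energy.\<close>

lemma energy_ge:
  assumes M: "M \<in> lmeasurable" "negligible (M - interior M)" "0 < measure lebesgue M"
    and N: "N \<in> lmeasurable" and \<phi>: "\<phi> \<in> Lip_inj_pos M N" and "2 \<le> p"
    and small: "2 * measure lebesgue N < measure lebesgue M"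
  shows "(1 - 2 * (measure lebesgue N / measure lebesgue M)) powr (p / 2) \<le> energy p M \<phi>"
proof -
  define bad where "bad = {x \<in> M. \<not> (\<phi> differentiable (at x within M) \<and> 0 \<le> det (jacobian \<phi> (at x within M)))}"
  define K where "K = {q \<in> N. \<not> (finite {x \<in> M. \<phi> x = q} \<and> card {x \<in> M. \<phi> x = q} \<le> 1)}"
  obtain L where L: "L-lipschitz_on M \<phi>" and maps: "\<phi> \<in> M \<rightarrow> N"
    and "negligible bad" "negligible K"
    using \<phi>
    unfolding Lip_inj_pos_def mem_Collect_eq AE_lebesgue_on_iff_negligible[OF fmeasurableD[OF M(1)]]
      AE_lebesgue_on_iff_negligible[OF fmeasurableD[OF N]] bad_def K_def
    by blast
  \<comment> \<open>A subset of full measure on which \<open>\<phi>\<close> has an ordinary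
    derivative with nonnegative determinant.\<close>
  define G where "G = interior M - bad"
  have G: "G \<in> sets lebesgue" "G \<subseteq> M"
    using negligible_imp_sets[OF \<open>negligible bad\<close>] interior_subset[of M]
    by (auto simp: G_def intro!: sets.Diff lmeasurable_open lborelD)
  have "negligible (M - G)"
    using negligible_Un[OF M(2) \<open>negligible bad\<close>] by (rule negligible_subset) (auto simp: G_def)
  have Gm: "G \<in> lmeasurable" "measure lebesgue G = measure lebesgue M"
  proof -
    show "G \<in> lmeasurable"
      using M(1) G by (meson fmeasurableI2)
    show "measure lebesgue G = measure lebesgue M"
      using measure_negligible_symdiff[OF M(1), of G] G(2) \<open>negligible (M - G)\<close>
      by (simp add: Diff_eq_empty_iff)
  qed
  define f' where "f' x = frechet_derivative \<phi> (at x)" for x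
  have at: "at x within M = at x" if "x \<in> G" for x
    using that at_within_interior[of x M] by (simp add: G_def)
  have der: "(\<phi> has_derivative f' x) (at x)" if "x \<in> G" for x
  proof -
    have "\<phi> differentiable (at x within M)"
      using that G(2) by (auto simp: G_def bad_def)
    then show ?thesis
      using at[OF that] by (simp add: f'_def frechet_derivative_works)
  qed
  have jac: "jacobian \<phi> (at x) = matrix (f' x)" for x
    by (simp add: jacobian_def f'_def)
  let ?d = "\<lambda>x. det (matrix (f' x))"
  \<comment> \<open>Off the exceptional null set \<open>K\<close> every fibre has at most one
    point.\<close>
  have inj: "inj_on \<phi> {x \<in> G. \<phi> x \<notin> K}"
  proof (rule inj_onI)
    fix x y assume xy: "x \<in> {x \<in> G. \<phi> x \<notin> K}" "y \<in> {x \<in> G. \<phi> x \<notin> K}" "\<phi> x = \<phi> y"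
    then have "finite {z \<in> M. \<phi> z = \<phi> x}" "card {z \<in> M. \<phi> z = \<phi> x} \<le> Suc 0"
      using G(2) maps by (auto simp: K_def)
    then show "x = y"
      using xy G(2) by (auto simp: card_le_Suc0_iff_eq)
  qed
  have nonneg: "0 \<le> ?d x" if "x \<in> G" for x
    using that at[OF that] G(2) by (auto simp: G_def bad_def jac)
  have "\<phi> ` G \<subseteq> N"
    using maps G(2) by auto
  note area = integral_det_le_measure[OF G(1) N this \<open>negligible K\<close>
      has_derivative_at_withinI[OF der] nonneg inj]
  have d: "?d integrable_on G" "integral G ?d \<le> measure lebesgue N"
    using area set_lebesgue_integral_eq_integral(1) by auto

  let ?h = "\<lambda>x. infdist (jacobian \<phi> (at x)) SO2 powr p"
  have "(\<lambda>x. matrix (f' x)) \<in> borel_measurable (lebesgue_on G)"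
    unfolding borel_measurable_euclidean_space[where f = "\<lambda>x. matrix (f' x)"]
    using borel_measurable_partial_derivatives[OF G(1) has_derivative_at_withinI[OF der]]
    by (auto simp: Basis_vec_def inner_axis)
  moreover have "(\<lambda>A :: real^2^2. infdist A SO2) \<in> borel_measurable borel"
    by (intro borel_measurable_continuous_onI continuous_on_infdist continuous_on_id)
  ultimately have "(\<lambda>x. infdist (matrix (f' x)) SO2) \<in> borel_measurable (lebesgue_on G)"
    by (rule measurable_compose)
  then have h_meas: "?h \<in> borel_measurable (lebesgue_on G)"
    unfolding jac by measurable
  \<comment> \<open>A bounded density is integrable on the finite-measure set \<open>G\<close>; this
    excludes the default value 0 of the Bochner integral.\<close>
  have h_le: "norm (?h x) \<le> (2 * L + norm (mat 1 :: real^2^2)) powr p" if "x \<in> G" for x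
  proof -
    have "x \<in> interior M" using that by (simp add: G_def)
    then have bound: "norm (f' x v) \<le> L * norm v" for v
      using norm_derivative_le_lipschitz[OF lipschitz_on_subset[OF L interior_subset] open_interior _ der[OF that]]
      by blast
    have "\<bar>matrix (f' x) $ i $ j\<bar> \<le> L" for i j
      using component_le_norm_cart[of "f' x (axis j 1)" i] bound[of "axis j 1"]
      by (simp add: matrix_def)
    then have "norm (matrix (f' x)) \<le> 2 * L"
      by (rule norm_matrix_2_le)
    moreover have "infdist (matrix (f' x)) SO2 \<le> norm (matrix (f' x)) + norm (mat 1 :: real^2^2)"
      using infdist_le[OF mat_1_in_SO2, of "matrix (f' x)"] norm_triangle_ineq4[of "matrix (f' x)" "mat 1"]
      by (simp add: dist_norm)
    ultimately show ?thesis
      using \<open>2 \<le> p\<close> by (auto simp: jac infdist_nonneg intro!: powr_mono2)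
  qed
  have h: "?h absolutely_integrable_on G"
    using h_meas G(1) integrable_on_const[OF Gm(1)] h_le
    by (rule measurable_bounded_by_integrable_imp_absolutely_integrable)

  define m where "m = measure lebesgue M"
  \<comment> \<open>The value of 1 - 2 det when the determinant is constantly the area ratio;
    \<open>c\<close> is the slope of \<open>y powr (p / 2)\<close> at this point.\<close>
  define y0 where "y0 = 1 - 2 * (measure lebesgue N / m)"
  define c where "c = p / 2 * y0 powr (p / 2 - 1)"
  have "m > 0" "y0 > 0" "c \<ge> 0"
    using M(3) small \<open>2 \<le> p\<close> by (auto simp: m_def y0_def c_def)
  have tangent: "(y0 powr (p / 2) + c * (1 - y0)) - (2 * c) * ?d x \<le> ?h x" for x
  proof -
    let ?i = "infdist (matrix (f' x)) SO2"
    have "y0 powr (p / 2) + c * (1 - y0) - (2 * c) * ?d x = y0 powr (p / 2) + c * ((1 - 2 * ?d x) - y0)"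
      by (simp add: algebra_simps)
    also have "\<dots> \<le> y0 powr (p / 2) + c * (?i\<^sup>2 - y0)"
      using infdist_SO2_ge \<open>c \<ge> 0\<close> by (intro add_left_mono mult_left_mono) auto
    also have "\<dots> \<le> (?i\<^sup>2) powr (p / 2)"
      unfolding c_def using \<open>2 \<le> p\<close> \<open>y0 > 0\<close> by (intro powr_above_tangent) auto
    also have "\<dots> = ?h x"
      by (simp add: jac powr_power2_half infdist_nonneg)
    finally show ?thesis .
  qed
  \<comment> \<open>The linear term cancels by the choice of tangent point:
    \<open>m * (1 - y0)\<close> equals \<open>2 * measure lebesgue N\<close>.\<close>
  have "m * y0 powr (p / 2) = m * (y0 powr (p / 2) + c * (1 - y0)) - (2 * c) * measure lebesgue N"
    using \<open>m > 0\<close> by (simp add: y0_def field_simps)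
  also have "\<dots> \<le> m * (y0 powr (p / 2) + c * (1 - y0)) - (2 * c) * integral G ?d"
    using d(2) \<open>c \<ge> 0\<close> by (intro diff_left_mono mult_left_mono) auto
  also have "\<dots> = integral G (\<lambda>x. (y0 powr (p / 2) + c * (1 - y0)) - (2 * c) * ?d x)"
  proof -
    have const: "integral G (\<lambda>x. k) = m * k" for k :: real
      using integral_mult_right[of G k "\<lambda>x. 1"] Gm by (simp add: m_def lmeasure_integral)
    show ?thesis
      by (subst Henstock_Kurzweil_Integration.integral_diff[OF integrable_on_const[OF Gm(1)]
            integrable_on_mult_right[OF d(1)]]) (simp add: const)
  qed
  also have "\<dots> \<le> integral G ?h"
    using tangent
    by (intro integral_le integrable_diff integrable_on_const integrable_on_mult_right
        d(1) Gm(1) set_lebesgue_integral_eq_integral(1)[OF h])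
  also have "\<dots> = integral\<^sup>L (lebesgue_on G) ?h"
    using absolutely_integrable_imp_integrable[OF h G(1)] G(1) by (simp add: lebesgue_integral_eq_integral)
  also have "\<dots> = m * energy p M \<phi>"
    using energy_eq_interior[OF fmeasurableD[OF M(1)] G(1) _ \<open>negligible (M - G)\<close>] \<open>m > 0\<close>
    by (simp add: G_def m_def)
  finally show ?thesis
    using \<open>m > 0\<close> by (simp add: y0_def m_def)
qed

section \<open>The punctured disk and the spirals as competitors\<close>

lemma punctured_disk_interior:
  "punctured_disk \<in> lmeasurable" "0 < measure lebesgue punctured_disk"
  "ball 0 1 - {0} \<subseteq> interior punctured_disk" "negligible (punctured_disk - (ball 0 1 - {0}))"
proof -
  show "punctured_disk \<in> lmeasurable"
    unfolding punctured_disk_def by (rule fmeasurableI2[OF lmeasurable_cball]) auto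
  have "negligible (cball (0 :: real^2) 1 - punctured_disk)"
    by (rule negligible_subset[of "{0}"]) (auto simp: punctured_disk_def)
  then have "measure lebesgue punctured_disk = measure lebesgue (cball (0 :: real^2) 1)"
    by (intro measure_negligible_symdiff) (auto simp: punctured_disk_def)
  then show "0 < measure lebesgue punctured_disk"
    by (simp add: content_cball_pos)
  show "ball 0 1 - {0} \<subseteq> interior punctured_disk"
    by (rule interior_maximal) (auto simp: punctured_disk_def open_delete)
  show "negligible (punctured_disk - (ball 0 1 - {0}))"
    by (rule negligible_subset[OF negligible_sphere[of 0 1]]) (auto simp: punctured_disk_def)
qed

lemma scaled_punctured_disk:
  assumes "0 < a"
  shows "(\<lambda>x. a *\<^sub>R x) ` punctured_disk = cball 0 a - {0}"
proof
  show "cball 0 a - {0} \<subseteq> (\<lambda>x. a *\<^sub>R x) ` punctured_disk"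
  proof
    fix y :: "real^2" assume "y \<in> cball 0 a - {0}"
    then show "y \<in> (\<lambda>x. a *\<^sub>R x) ` punctured_disk"
      using assms by (intro image_eqI[of _ _ "(1 / a) *\<^sub>R y"]) (auto simp: punctured_disk_def)
  qed
qed (use assms in \<open>auto simp: punctured_disk_def mult_left_le\<close>)

lemma measure_scaled_punctured_disk:
  "measure lebesgue ((\<lambda>x. a *\<^sub>R x) ` punctured_disk) = a\<^sup>2 * measure lebesgue punctured_disk"
  using measure_lebesgue_affine[of a "0 :: real^2" punctured_disk] by simp

text \<open>Inverting the parameters twice returns them, since
  \<open>- b * ln (1 / a) - (b * ln a - k) = k\<close>.\<close>

lemma spiral_right_inverse:
  assumes "a > 0" "y \<noteq> 0"
  shows "spiral a b k (spiral (1 / a) (- b) (b * ln a - k) y) = y"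
  using spiral_inverse[of "1 / a" y "- b" "b * ln a - k"] assms by (simp add: ln_div)

text \<open>The spiral itself, on the open set \<open>- {0}\<close>, serves as smooth extension
  around every point, those on the boundary circle included.\<close>

lemma smooth_map_on_spiral:
  assumes "S \<subseteq> - {0}" "\<And>x. x \<in> S \<Longrightarrow> f x = spiral a b k x"
  shows "smooth_map_on S f"
  unfolding smooth_map_on_def
proof
  fix x assume "x \<in> S"
  then show "\<exists>U g. open U \<and> x \<in> U \<and> (\<forall>k. C_diff_on k U g) \<and> (\<forall>y\<in>S \<inter> U. g y = f y)"
    using assms C_diff_on_spiral
    by (intro exI[of _ "- {0}"] exI[of _ "spiral a b k"]) auto
qed

lemma smooth_diffeo_spiral:
  assumes a: "0 < a"
  shows "smooth_diffeo punctured_disk ((\<lambda>x. a *\<^sub>R x) ` punctured_disk) (spiral a b k)"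
proof -
  let ?N = "(\<lambda>x. a *\<^sub>R x) ` punctured_disk" and ?g = "spiral (1 / a) (- b) (b * ln a - k)"
  have nz: "punctured_disk \<subseteq> - {0}" "?N \<subseteq> - {0}"
    using a by (auto simp: punctured_disk_def)
  have norm0: "spiral c d e x = 0 \<longleftrightarrow> c = 0 \<or> x = 0" for c d e x
    using norm_spiral[of c d e x] by (metis mult_eq_0_iff norm_eq_zero abs_eq_0)
  have g: "?g y \<in> punctured_disk" "spiral a b k (?g y) = y" if "y \<in> ?N" for y
    using a that spiral_right_inverse[of a y b k] unfolding scaled_punctured_disk[OF a]
    by (auto simp: punctured_disk_def norm_spiral norm0)
  have bij: "bij_betw (spiral a b k) punctured_disk ?N"
  proof (rule bij_betw_byWitness[where f' = ?g])
    show "\<forall>x\<in>punctured_disk. ?g (spiral a b k x) = x"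
      using a by (auto simp: punctured_disk_def spiral_inverse)
    show "spiral a b k ` punctured_disk \<subseteq> ?N"
      unfolding scaled_punctured_disk[OF a]
      using a by (auto simp: punctured_disk_def norm_spiral norm0 mult_left_le)
  qed (use g in auto)
  have "inv_into punctured_disk (spiral a b k) y = ?g y" if "y \<in> ?N" for y
    using bij g[OF that] by (intro inv_into_f_eq) (auto simp: bij_betw_def)
  then show ?thesis
    using bij nz by (auto simp: smooth_diffeo_def intro: smooth_map_on_spiral)
qed

lemma spiral_in_Lip_inj_pos:
  assumes a: "0 < a"
  shows "spiral a b k \<in> Lip_inj_pos punctured_disk ((\<lambda>x. a *\<^sub>R x) ` punctured_disk)"
proof -
  let ?N = "(\<lambda>x. a *\<^sub>R x) ` punctured_disk" and ?s = "spiral a b k"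
  have bij: "bij_betw ?s punctured_disk ?N"
    using smooth_diffeo_spiral[OF a] by (simp add: smooth_diffeo_def)
  have "AE x in lebesgue_on punctured_disk. ?s differentiable (at x within punctured_disk) \<and>
      0 \<le> det (jacobian ?s (at x within punctured_disk))"
    unfolding AE_lebesgue_on_iff_negligible[OF fmeasurableD[OF punctured_disk_interior(1)]]
  \<comment> \<open>The boundary circle is discarded as a null set, so that only ordinary
    differentials remain.\<close>
  proof (rule negligible_subset[OF punctured_disk_interior(4)])
    have "?s differentiable (at x within punctured_disk) \<and>
        0 \<le> det (jacobian ?s (at x within punctured_disk))" if "x \<in> ball 0 1 - {0}" for x
    proof -
      have "at x within punctured_disk = at x"
        using that punctured_disk_interior(3) by (blast intro: at_within_interior)
      then show ?thesis
        using that spiral_derivative_entries(1,2)[of x a b k] by simp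
    qed
    then show "{x \<in> punctured_disk. \<not> (?s differentiable (at x within punctured_disk) \<and>
        0 \<le> det (jacobian ?s (at x within punctured_disk)))} \<subseteq> punctured_disk - (ball 0 1 - {0})"
      by blast
  qed
  moreover have "finite {x \<in> punctured_disk. ?s x = q} \<and> card {x \<in> punctured_disk. ?s x = q} \<le> 1" for q
  proof -
    have *: "{x \<in> punctured_disk. ?s x = q} \<subseteq> {inv_into punctured_disk ?s q}"
      using bij by (auto simp: bij_betw_def)
    show ?thesis
      using finite_subset[OF *] card_mono[OF _ *] by simp
  qed
  moreover have "?s \<in> punctured_disk \<rightarrow> ?N"
    using bij by (auto simp: bij_betw_def)
  moreover have "\<exists>L. L-lipschitz_on punctured_disk ?s"
    using lipschitz_on_subset[OF spiral_lipschitz, of punctured_disk] by (auto simp: punctured_disk_def)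
  ultimately show ?thesis
    unfolding Lip_inj_pos_def by blast
qed

text \<open>The assumption is the equality condition of \<open>infdist_SO2_eq\<close> for the
  differential of the spiral. Its determinant is constant, so the density is constant as
  well.\<close>

lemma energy_spiral:
  assumes "a\<^sup>2 * (4 + b\<^sup>2) = 1"
  shows "energy p punctured_disk (spiral a b k) = (1 - 2 * a\<^sup>2) powr (p / 2)"
proof -
  let ?G = "ball 0 1 - {0} :: (real^2) set" and ?c = "(1 - 2 * a\<^sup>2) powr (p / 2)"
  have G: "?G \<in> sets lebesgue" by simp
  have "infdist (jacobian (spiral a b k) (at x)) SO2 powr p = ?c" if "x \<in> ?G" for x
  proof -
    let ?A = "jacobian (spiral a b k) (at x)"
    have "(infdist ?A SO2)\<^sup>2 = 1 - 2 * a\<^sup>2"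
      using that assms infdist_SO2_eq[of ?A] spiral_derivative_entries(2,3)[of x a b k] by simp
    then show ?thesis
      by (metis powr_power2_half infdist_nonneg)
  qed
  then have "(\<integral>x. infdist (jacobian (spiral a b k) (at x)) SO2 powr p \<partial>(lebesgue_on ?G)) =
      (\<integral>x. ?c \<partial>(lebesgue_on ?G))"
    by (intro Bochner_Integration.integral_cong) auto
  \<comment> \<open>Back to the whole disk, whose area then cancels against the normalization of the
    energy.\<close>
  also have "\<dots> = (\<integral>x. ?c \<partial>(lebesgue_on punctured_disk))"
    by (rule integral_lebesgue_on_spike_set[OF fmeasurableD[OF punctured_disk_interior(1)] G
        order_trans[OF punctured_disk_interior(3) interior_subset] punctured_disk_interior(4), symmetric])
  also have "\<dots> = measure lebesgue punctured_disk * ?c"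
    using punctured_disk_interior(1) by (simp add: measure_restrict_space fmeasurableD)
  finally show ?thesis
    using energy_eq_interior[OF fmeasurableD[OF punctured_disk_interior(1)] G punctured_disk_interior(3,4)]
      punctured_disk_interior(2) by simp
qed

theorem proposition1p4:
  fixes l p :: real
  assumes "0 < l" and "l \<le> 1/2" and "2 \<le> p"
  shows "bdd_below (energy p punctured_disk `
            Lip_inj_pos punctured_disk ((\<lambda>x. l *\<^sub>R x) ` punctured_disk))
    \<and> (INF \<phi>\<in>Lip_inj_pos punctured_disk ((\<lambda>x. l *\<^sub>R x) ` punctured_disk).
            energy p punctured_disk \<phi>) = F (l\<^sup>2) powr (p/2)
    \<and> (\<exists>\<phi>\<in>Lip_inj_pos punctured_disk ((\<lambda>x. l *\<^sub>R x) ` punctured_disk).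
          energy p punctured_disk \<phi> = F (l\<^sup>2) powr (p/2)
          \<and> (\<forall>\<psi>\<in>Lip_inj_pos punctured_disk ((\<lambda>x. l *\<^sub>R x) ` punctured_disk).
                energy p punctured_disk \<phi> \<le> energy p punctured_disk \<psi>)
          \<and> smooth_diffeo punctured_disk ((\<lambda>x. l *\<^sub>R x) ` punctured_disk) \<phi>)"
proof -
  let ?N = "(\<lambda>x. l *\<^sub>R x) ` punctured_disk"
  let ?X = "Lip_inj_pos punctured_disk ?N" and ?E = "energy p punctured_disk"
  \<comment> \<open>Selects the affine branch of \<open>F\<close>.\<close>
  have l2: "l\<^sup>2 \<le> 1 / 4"
    using power_mono[OF assms(2), of 2] assms(1) by (simp add: power2_eq_square)
  then have F: "F (l\<^sup>2) = 1 - 2 * l\<^sup>2"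
    by (simp add: F_def)
  have m: "measure lebesgue ?N = l\<^sup>2 * measure lebesgue punctured_disk"
    by (rule measure_scaled_punctured_disk)
  have lower: "F (l\<^sup>2) powr (p/2) \<le> ?E \<psi>" if "\<psi> \<in> ?X" for \<psi>
  proof -
    have "punctured_disk - interior punctured_disk \<subseteq> punctured_disk - (ball 0 1 - {0})"
      using punctured_disk_interior(3) by blast
    then have "negligible (punctured_disk - interior punctured_disk)"
      using punctured_disk_interior(4) negligible_subset by blast
    moreover have "?N \<in> lmeasurable"
      unfolding scaled_punctured_disk[OF assms(1)]
      by (rule fmeasurableI2[OF lmeasurable_cball]) auto
    \<comment> \<open>The area ratio is at most 1/4; strictness comes from the positive area of the
      disk.\<close>
    moreover have "2 * measure lebesgue ?N < measure lebesgue punctured_disk"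
      unfolding m using mult_right_mono[OF l2, of "measure lebesgue punctured_disk"]
        punctured_disk_interior(2) by linarith
    ultimately show ?thesis
      using energy_ge[of punctured_disk ?N \<psi> p] that assms(3) punctured_disk_interior(1,2)
      by (simp add: F m)
  qed
  \<comment> \<open>Solves \<open>l\<^sup>2 * (4 + b\<^sup>2) = 1\<close>; the radicand is
    nonnegative because \<open>l \<le> 1/2\<close>. For \<open>l = 1/2\<close> it vanishes and the
    minimizer is plain scaling.\<close>
  define b where "b = sqrt (1 / l\<^sup>2 - 4)"
  have "4 \<le> 1 / l\<^sup>2"
    using l2 assms(1) by (simp add: field_simps)
  then have "l\<^sup>2 * (4 + b\<^sup>2) = 1"
    using assms(1) by (simp add: b_def)
  then have E: "?E (spiral l b 0) = F (l\<^sup>2) powr (p/2)"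
    using energy_spiral F by simp
  have X: "spiral l b 0 \<in> ?X"
    using assms(1) by (rule spiral_in_Lip_inj_pos)
  have "(INF \<phi>\<in>?X. ?E \<phi>) = F (l\<^sup>2) powr (p/2)"
    by (rule cInf_eq_minimum) (use X E lower in \<open>auto intro!: image_eqI[of _ _ "spiral l b 0"]\<close>)
  moreover have "bdd_below (?E ` ?X)"
    using lower by (intro bdd_belowI2)
  ultimately show ?thesis
    using X E lower smooth_diffeo_spiral[OF assms(1)] by auto
qed

end
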